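(* (i) If $p\geq 3$ is a prime, then for all integers $n\geq 0$, $\alpha\geq 0$, $\delta\geq 0$ and all $t\in\{1,2,\ldots,p-1\}$, $$\overline{OPT}\left(2\cdot 3^{2\alpha}\cdot p^{2\delta+1}(pn+t)+3^{2\alpha}\cdot p^{2(\delta+1)}\right)\equiv 0 \pmod 4.$$ (ii) If $p>3$ is a prime satisfying $\left(\frac{-2}{p}\right)=-1$ (Legendre symbol), then for all integers $n\geq 0$, $\alpha\geq 0$, $\delta\geq 0$ and all $r\in\{1,2,\ldots,p-1\}$, $$\overline{OPT}\left(8\cdot 3^{2\alpha}\cdot p^{2\delta+1}(pn+r)+3^{2\alpha}\cdot p^{2(\delta+1)}\right)\equiv 0 \pmod 8.$$
   Context: An overpartition of a nonnegative integer $n$ is a non-increasing sequence of positive integers with sum $n$ in which the first occurrence of each number may be overlined. An overpartition triple of $n$ with odd parts is an (ordered) triple $(\xi_1,\xi_2,\xi_3)$ of overpartitions, all of whose parts are odd, such that the sum of all the parts of $\xi_1,\xi_2,\xi_3$ is $n$. $\overline{OPT}(n)$ denotes the number of overpartition triples of $n$ with odd parts. Its generating function is $$\sum_{n\geq 0}\overline{OPT}(n)q^n=\frac{f_2^9}{f_1^6f_4^3}=\prod_{i\geq 0}\left(\frac{1+q^{2i+1}}{1-q^{2i+1}}\right)^3,\qquad f_k:=\prod_{i\geq 1}(1-q^{ki}).$$ *)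

theory Defs
  imports "HOL-Number_Theory.Number_Theory"
begin

text \<open>
  An overpartition is a list of pairs of a part and a flag telling whether this occurrence
  of the part is overlined. Only the first occurrence of a number may carry the flag.
\<close>

type_synonym part = "nat \<times> bool"

definition overpartition :: "part list \<Rightarrow> bool" where
  "overpartition xs \<longleftrightarrow>
     sorted_wrt (\<ge>) (map fst xs) \<and>
     (\<forall>x\<in>set xs. fst x > 0) \<and>
     (\<forall>i<length xs. snd (xs ! i) \<longrightarrow> (\<forall>j<i. fst (xs ! j) \<noteq> fst (xs ! i)))"

definition weight :: "part list \<Rightarrow> nat" where
  "weight xs = sum_list (map fst xs)"

definition odd_overpartition :: "part list \<Rightarrow> bool" where
  "odd_overpartition xs \<longleftrightarrow> overpartition xs \<and> (\<forall>x\<in>set xs. odd (fst x))"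

definition odd_overpartition_triples :: "nat \<Rightarrow> (part list \<times> part list \<times> part list) set" where
  "odd_overpartition_triples n =
     {(xs, ys, zs). odd_overpartition xs \<and> odd_overpartition ys \<and> odd_overpartition zs \<and>
        weight xs + weight ys + weight zs = n}"

definition OPT :: "nat \<Rightarrow> nat" where
  "OPT n = card (odd_overpartition_triples n)"

text \<open>The sets counted by \<^const>\<open>OPT\<close> are finite, so the cardinality is the genuine one.\<close>

lemma length_le_weight: "(\<forall>x\<in>set xs. fst x > 0) \<Longrightarrow> length xs \<le> weight xs"
  by (induction xs) (auto simp: weight_def Suc_le_eq intro: add_less_le_mono)

lemma part_le_weight: "x \<in> set xs \<Longrightarrow> fst x \<le> weight xs"
  by (auto simp: weight_def intro!: member_le_sum_list)

lemma finite_odd_overpartition_triples: "finite (odd_overpartition_triples n)"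
proof -
  let ?L = "{xs :: part list. set xs \<subseteq> {..n} \<times> UNIV \<and> length xs \<le> n}"
  have L: "xs \<in> ?L" if "odd_overpartition xs" "weight xs \<le> n" for xs
  proof -
    have "length xs \<le> weight xs"
      using that by (intro length_le_weight) (auto simp: odd_overpartition_def overpartition_def)
    moreover have "fst x \<le> n" if "x \<in> set xs" for x
      using part_le_weight[OF that] \<open>weight xs \<le> n\<close> by linarith
    ultimately show ?thesis using \<open>weight xs \<le> n\<close> by force
  qed
  have "odd_overpartition_triples n \<subseteq> ?L \<times> ?L \<times> ?L"
  proof
    fix w assume w: "w \<in> odd_overpartition_triples n"
    obtain xs ys zs where [simp]: "w = (xs, ys, zs)" by (cases w)
    show "w \<in> ?L \<times> ?L \<times> ?L"
      using w L[of xs] L[of ys] L[of zs]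
      by (simp add: odd_overpartition_triples_def mem_Times_iff)
  qed
  moreover have "finite (?L \<times> ?L \<times> ?L)"
    by (intro finite_cartesian_product finite_lists_length_le) auto
  ultimately show ?thesis by (rule finite_subset)
qed

end

theory Submission
  imports Defs "HOL-Computational_Algebra.Formal_Power_Series"
begin

text \<open>
  With $x_k = q^k/(1-q^k)$ the generating function is the cube of $\prod (1 + 2x_k)$ over odd $k$.
  Expanding it modulo 8 and using $e_1^2 = p_2 + 2e_2$ expresses \<open>OPT N\<close>, for odd $N$, through
  the number $d(N)$ of divisors of $N$, the divisor sum $p_2$ and the convolution of the odd-divisor
  counts of $m$ and $N - m$ for even $m$. If $N$ is not a square then $d(N)$ is even, which suffices
  modulo 4. If moreover $N \equiv 1$ modulo 4 and $N$ is not of the form $x^2 + 2y^2$, the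
  convolution has the parity of the number of solutions of $x^2 + 4y^2 = N$, because an odd-divisor
  count is odd only at squares and doubled squares. Zagier's involution shows that this number has
  the parity of $d(N)/2$, and everything cancels modulo 8. The arguments in the theorem contain $p$
  to an odd power, so they are neither squares nor, when $-2$ is a nonresidue, of the form
  $x^2 + 2y^2$.
\<close>

unbundle fps_syntax

section \<open>Parity by involutions, weighted pairs, and a product expansion\<close>

text \<open>Points moved by the involution fall into orbits of size two; the induction removes one
  orbit \<open>{a, f a}\<close> at a time.\<close>

lemma even_card_iff_even_card_fixpoints:
  assumes "finite S" "\<And>x. x \<in> S \<Longrightarrow> f x \<in> S" "\<And>x. x \<in> S \<Longrightarrow> f (f x) = x"
  shows "even (card S) \<longleftrightarrow> even (card {x \<in> S. f x = x})"
  using assms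
proof (induction S rule: finite_psubset_induct)
  case (psubset S)
  show ?case
  proof (cases "\<exists>x\<in>S. f x \<noteq> x")
    case False
    then have "{x \<in> S. f x = x} = S" by auto
    then show ?thesis by simp
  next
    case True
    then obtain a where a: "a \<in> S" "f a \<noteq> a" by blast
    let ?T = "S - {a, f a}"
    have fa: "f a \<in> S" "f (f a) = a" using psubset.prems a by auto
    have "even (card ?T) \<longleftrightarrow> even (card {x \<in> ?T. f x = x})"
    proof (rule psubset.IH)
      show "?T \<subset> S" using a by blast
      fix x assume x: "x \<in> ?T"
      have "f x \<noteq> a" "f x \<noteq> f a"
        using x a psubset.prems(2)[of x] fa by (metis DiffD1 DiffD2 insertCI)+
      then show "f x \<in> ?T" using x psubset.prems by auto
      show "f (f x) = x" using x psubset.prems by auto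
    qed
    moreover have "{x \<in> ?T. f x = x} = {x \<in> S. f x = x}" using a fa by auto
    moreover have "card S = card ?T + 2"
      using card_Diff_subset[of "{a, f a}" S] a fa psubset.hyps card_mono[of S "{a, f a}"] by auto
    ultimately show ?thesis by simp
  qed
qed

text \<open>The combinatorial Cauchy product, splitting by the weight of the first component. Two
  applications turn triples into a coefficient of a cube.\<close>

lemma card_pairs_add_eq:
  fixes v :: "'a \<Rightarrow> nat" and w :: "'b \<Rightarrow> nat"
  assumes "\<And>i. i \<le> n \<Longrightarrow> finite {x. P x \<and> v x = i}" "\<And>i. i \<le> n \<Longrightarrow> finite {y. Q y \<and> w y = i}"
  shows "card {(x, y). P x \<and> Q y \<and> v x + w y = n} =
    (\<Sum>i=0..n. card {x. P x \<and> v x = i} * card {y. Q y \<and> w y = n - i})"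
proof -
  have "{(x, y). P x \<and> Q y \<and> v x + w y = n} =
      (\<Union>i\<in>{0..n}. {x. P x \<and> v x = i} \<times> {y. Q y \<and> w y = n - i})"
    by auto
  also have "card \<dots> = (\<Sum>i\<in>{0..n}. card ({x. P x \<and> v x = i} \<times> {y. Q y \<and> w y = n - i}))"
    using assms by (intro card_UN_disjoint) auto
  finally show ?thesis by (simp add: card_cartesian_product)
qed

text \<open>The witness $e$ is the second elementary symmetric polynomial of the $x_k$.\<close>

lemma prod_one_plus_double:
  fixes x :: "'a \<Rightarrow> 'b :: comm_ring_1"
  assumes "finite A"
  shows "\<exists>e z. (\<Prod>k\<in>A. 1 + 2 * x k) = 1 + 2 * (\<Sum>k\<in>A. x k) + 4 * e + 8 * z \<and>
    (\<Sum>k\<in>A. x k)\<^sup>2 = (\<Sum>k\<in>A. (x k)\<^sup>2) + 2 * e"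
  using assms
proof (induction A rule: finite_induct)
  case empty
  have "(\<Prod>k\<in>{}. 1 + 2 * x k) = 1 + 2 * (\<Sum>k\<in>{}. x k) + 4 * 0 + 8 * 0 \<and>
    (\<Sum>k\<in>{}. x k)\<^sup>2 = (\<Sum>k\<in>{}. (x k)\<^sup>2) + 2 * 0" by simp
  then show ?case by blast
next
  case (insert a A)
  then obtain e z where e: "(\<Prod>k\<in>A. 1 + 2 * x k) = 1 + 2 * (\<Sum>k\<in>A. x k) + 4 * e + 8 * z"
    "(\<Sum>k\<in>A. x k)\<^sup>2 = (\<Sum>k\<in>A. (x k)\<^sup>2) + 2 * e" by blast
  \<comment> \<open>The new witnesses are read off from multiplying the old expansion by
    \<open>1 + 2 * x a\<close> and sorting the terms by 4 and 8.\<close>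
  show ?case
    using insert.hyps e
    by (intro exI[of _ "e + x a * (\<Sum>k\<in>A. x k)"] exI[of _ "z + x a * e + 2 * x a * z"])
      (simp add: algebra_simps power2_eq_square)
qed

subsection \<open>The generating function\<close>

text \<open>Bounding the parts by \<open>K\<close> makes the generating function a finite product,
  so no infinite product of series is needed.\<close>

definition bounded_odd_overpartitions :: "nat \<Rightarrow> nat \<Rightarrow> part list set" where
  "bounded_odd_overpartitions K n =
    {xs. (odd_overpartition xs \<and> (\<forall>x\<in>set xs. fst x \<le> K)) \<and> weight xs = n}"

lemma odd_overpartition_Nil [simp]: "odd_overpartition []"
  by (simp add: odd_overpartition_def overpartition_def)

lemma weight_Nil [simp]: "weight [] = 0" and
  weight_Cons [simp]: "weight (x # xs) = fst x + weight xs"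
  by (simp_all add: weight_def)

text \<open>The head is a first occurrence, so its flag is free; an overlined part of the tail must
  differ from it to remain a first occurrence.\<close>

lemma odd_overpartition_Cons:
  "odd_overpartition (x # xs) \<longleftrightarrow> odd (fst x) \<and> odd_overpartition xs \<and>
    (\<forall>y\<in>set xs. fst y \<le> fst x \<and> (snd y \<longrightarrow> fst y \<noteq> fst x))"
proof -
  have "(\<forall>i<length (x # xs). snd ((x # xs) ! i) \<longrightarrow> (\<forall>j<i. fst ((x # xs) ! j) \<noteq> fst ((x # xs) ! i)))
    \<longleftrightarrow> (\<forall>i<length xs. snd (xs ! i) \<longrightarrow> fst x \<noteq> fst (xs ! i) \<and> (\<forall>j<i. fst (xs ! j) \<noteq> fst (xs ! i)))"
    by (simp add: All_less_Suc2)
  moreover have "(\<forall>y\<in>set xs. snd y \<longrightarrow> fst y \<noteq> fst x) \<longleftrightarrow>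
      (\<forall>i<length xs. snd (xs ! i) \<longrightarrow> fst x \<noteq> fst (xs ! i))"
    by (auto simp: all_set_conv_all_nth)
  ultimately show ?thesis
    unfolding odd_overpartition_def overpartition_def by (auto simp: odd_pos)
qed

lemma finite_bounded_odd_overpartitions: "finite (bounded_odd_overpartitions K n)"
proof -
  have "bounded_odd_overpartitions K n \<subseteq>
      (\<lambda>xs. (xs, [], [])) -` odd_overpartition_triples n"
    by (auto simp: bounded_odd_overpartitions_def odd_overpartition_triples_def)
  moreover have "finite ((\<lambda>xs. (xs, [], [])) -` odd_overpartition_triples n)"
    by (intro finite_vimageI finite_odd_overpartition_triples) (auto simp: inj_def)
  ultimately show ?thesis by (rule finite_subset)
qed

text \<open>For \<open>k > 0\<close> this is the series $x_k = q^k/(1-q^k)$, given by its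
  coefficients.\<close>

definition multiples_fps :: "nat \<Rightarrow> int fps" where
  "multiples_fps k = Abs_fps (\<lambda>n. if n > 0 \<and> k dvd n then 1 else 0)"

lemma multiples_fps_geometric:
  assumes "k > 0"
  shows "(1 - fps_X ^ k) * multiples_fps k = fps_X ^ k"
proof (rule fps_ext)
  fix n
  have "(multiples_fps k - fps_X ^ k * multiples_fps k) $ n = (fps_X ^ k) $ n"
    using assms unfolding fps_sub_nth fps_X_power_mult_nth fps_X_power_nth
    by (auto simp: multiples_fps_def dvd_minus_self dest: dvd_imp_le)
  then show "((1 - fps_X ^ k) * multiples_fps k) $ n = fps_X ^ k $ n"
    by (simp add: algebra_simps)
qed

abbreviation bounded_fps :: "nat \<Rightarrow> int fps" where
  "bounded_fps K \<equiv> Abs_fps (\<lambda>n. int (card (bounded_odd_overpartitions K n)))"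

text \<open>Let \<open>D\<close> count the lists without an overlined \<open>Suc K\<close>.
  Stripping a leading \<open>Suc K\<close> gives two linear relations, one for the wanted series and
  one for \<open>D\<close>; eliminating \<open>D\<close> yields the factor $(1+X)/(1-X) = 1 +
  2X/(1-X)$ with $X = q^{K+1}$.\<close>

lemma bounded_fps_odd:
  assumes "odd (Suc K)"
  shows "bounded_fps (Suc K) = (1 + 2 * multiples_fps (Suc K)) * bounded_fps K"
proof -
  define C where "C = bounded_odd_overpartitions"
  define D where "D n = {xs \<in> C (Suc K) n. (Suc K, True) \<notin> set xs}" for n
  let ?X = "fps_X ^ Suc K :: int fps" and ?D = "Abs_fps (\<lambda>n. int (card (D n)))"
  have finC: "finite (C k n)" for k n
    by (simp add: C_def finite_bounded_odd_overpartitions)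
  then have finD: "finite (D n)" for n by (simp add: D_def)
  \<comment> \<open>Parts are non-increasing, so a head different from \<open>Suc K\<close> bounds
    every part by \<open>K\<close>.\<close>
  have hd_le: "xs \<in> C K n" if "xs \<in> C (Suc K) n" "xs = [] \<or> fst (hd xs) \<noteq> Suc K" for xs n
    using that by (cases xs) (fastforce simp: C_def bounded_odd_overpartitions_def odd_overpartition_Cons)+
  have Cons_C: "(Suc K, b) # xs \<in> C (Suc K) n \<longleftrightarrow> Suc K \<le> n \<and> xs \<in> D (n - Suc K)" for b xs n
    using assms by (auto simp: C_def D_def bounded_odd_overpartitions_def odd_overpartition_Cons)
  have C_mono: "C K n \<subseteq> C (Suc K) n" for n
    by (auto simp: C_def bounded_odd_overpartitions_def)
  have Suc_notin: "(Suc K, b) \<notin> set xs" if "xs \<in> C K n" for b xs n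
    using that by (force simp: C_def bounded_odd_overpartitions_def)
  have C_eq: "C (Suc K) n = C K n \<union> (if Suc K \<le> n then
      Cons (Suc K, True) ` D (n - Suc K) \<union> Cons (Suc K, False) ` D (n - Suc K) else {})"
    (is "_ = ?R") for n
  proof (intro equalityI subsetI)
    fix xs assume xs: "xs \<in> C (Suc K) n"
    show "xs \<in> ?R"
    proof (cases "xs = [] \<or> fst (hd xs) \<noteq> Suc K")
      case True
      then show ?thesis using hd_le[OF xs] by simp
    next
      case False
      then obtain b ys where "xs = (Suc K, b) # ys" by (cases xs) auto
      then show ?thesis using xs Cons_C by (cases b) auto
    qed
  next
    fix xs assume "xs \<in> ?R"
    then show "xs \<in> C (Suc K) n" using C_mono Cons_C by (auto split: if_splits)
  qed
  have D_eq: "D n = C K n \<union> (if Suc K \<le> n then Cons (Suc K, False) ` D (n - Suc K) else {})" for n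
    unfolding D_def[of n] C_eq[of n]
    using Suc_notin by (auto simp: D_def split: if_splits)
  have card_C: "card (C (Suc K) n) = card (C K n) + (if Suc K \<le> n then 2 * card (D (n - Suc K)) else 0)" for n
  proof (cases "Suc K \<le> n")
    case True
    have "card (C K n \<union> (Cons (Suc K, True) ` D (n - Suc K) \<union> Cons (Suc K, False) ` D (n - Suc K)))
      = card (C K n) + (card (Cons (Suc K, True) ` D (n - Suc K)) + card (Cons (Suc K, False) ` D (n - Suc K)))"
      using finC finD Suc_notin
      by (subst card_Un_disjoint, simp_all, force) (subst card_Un_disjoint, auto)
    then show ?thesis using True by (simp add: C_eq card_image)
  qed (simp add: C_eq)
  have card_D: "card (D n) = card (C K n) + (if Suc K \<le> n then card (D (n - Suc K)) else 0)" for n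
  proof (cases "Suc K \<le> n")
    case True
    have "card (C K n \<union> Cons (Suc K, False) ` D (n - Suc K))
      = card (C K n) + card (Cons (Suc K, False) ` D (n - Suc K))"
      using finC finD Suc_notin by (intro card_Un_disjoint) (simp_all, force)
    then show ?thesis using True by (simp add: D_eq[of n] card_image)
  qed (simp add: D_eq[of n])
  text \<open>
    Removing the first part of a list in \<open>C (Suc K)\<close> that starts with \<open>Suc K\<close> leaves a list in \<open>D\<close>,
    whether or not that part was overlined.
  \<close>
  have gf_C: "bounded_fps (Suc K) = bounded_fps K + 2 * (?X * ?D)"
    unfolding numeral_fps_const
    by (rule fps_ext) (simp add: fps_X_power_mult_nth card_C[unfolded C_def] del: power_Suc)
  have gf_D: "?D = bounded_fps K + ?X * ?D"
    by (rule fps_ext, subst fps_add_nth, subst fps_X_power_mult_nth) (simp add: card_D C_def)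
  \<comment> \<open>Writing \<open>?X\<close> as a multiple of \<open>1 - ?X\<close> lets that
    factor act on \<open>?D\<close>, where \<open>gf_D\<close> evaluates it.\<close>
  have "?X * ?D = (1 - ?X) * multiples_fps (Suc K) * ?D"
    by (simp only: multiples_fps_geometric zero_less_Suc)
  also have "\<dots> = multiples_fps (Suc K) * (?D - ?X * ?D)"
    by (simp add: algebra_simps del: power_Suc)
  also have "?D - ?X * ?D = bounded_fps K" using gf_D by (simp add: algebra_simps del: power_Suc)
  finally show ?thesis using gf_C by (simp add: algebra_simps del: power_Suc)
qed

lemma bounded_fps_even:
  assumes "even (Suc K)"
  shows "bounded_fps (Suc K) = bounded_fps K"
proof -
  have "bounded_odd_overpartitions (Suc K) n = bounded_odd_overpartitions K n" for n
  proof -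
    have "(\<forall>x\<in>set xs. fst x \<le> Suc K) \<longleftrightarrow> (\<forall>x\<in>set xs. fst x \<le> K)" if "odd_overpartition xs" for xs
    proof (intro ball_cong refl)
      fix x assume "x \<in> set xs"
      then have "fst x \<noteq> Suc K" using that assms by (auto simp: odd_overpartition_def)
      then show "fst x \<le> Suc K \<longleftrightarrow> fst x \<le> K" by (simp add: le_Suc_eq)
    qed
    then show ?thesis unfolding bounded_odd_overpartitions_def by blast
  qed
  then show ?thesis by simp
qed

lemma bounded_fps_eq_prod:
  "bounded_fps K = (\<Prod>k | odd k \<and> k \<le> K. 1 + 2 * multiples_fps k)"
proof (induction K)
  case 0
  have "bounded_odd_overpartitions 0 n = (if n = 0 then {[]} else {})" for n
  proof -
    have "xs = []" if "odd_overpartition xs" "\<forall>x\<in>set xs. fst x \<le> 0" for xs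
      using that by (cases xs) (auto simp: odd_overpartition_Cons)
    then have "bounded_odd_overpartitions 0 n = {xs. xs = [] \<and> weight xs = n}"
      unfolding bounded_odd_overpartitions_def by fastforce
    also have "\<dots> = (if n = 0 then {[]} else {})" by (auto simp del: weight_Cons)
    finally show ?thesis .
  qed
  then have "bounded_fps 0 = 1" by (simp add: fps_eq_iff)
  moreover have "{k. odd k \<and> k \<le> (0::nat)} = {}" by (auto simp: odd_pos)
  ultimately show ?case by (simp only: prod.empty)
next
  case (Suc K)
  show ?case
  proof (cases "odd (Suc K)")
    case True
    then have "{k. odd k \<and> k \<le> Suc K} = insert (Suc K) {k. odd k \<and> k \<le> K}"
      by (auto simp: le_Suc_eq)
    then show ?thesis using bounded_fps_odd[OF True] Suc by simp
  next
    case False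
    then have "{k. odd k \<and> k \<le> Suc K} = {k. odd k \<and> k \<le> K}"
      by (auto simp: le_Suc_eq)
    then show ?thesis using bounded_fps_even[of K] Suc False by simp
  qed
qed

text \<open>No part exceeds the total weight \<open>n\<close>, so the bound \<open>n\<close> on the
  parts loses nothing. A triple is treated as a list together with a pair of lists.\<close>

lemma OPT_eq_fps_nth: "int (OPT n) = (bounded_fps n ^ 3) $ n"
proof -
  define P where "P xs \<longleftrightarrow> odd_overpartition xs \<and> (\<forall>x\<in>set xs. fst x \<le> n)" for xs
  have P: "{xs. P xs \<and> weight xs = i} = bounded_odd_overpartitions n i" for i
    by (simp add: P_def bounded_odd_overpartitions_def)
  have "odd_overpartition_triples n =
      {(xs, y). P xs \<and> (case y of (ys, zs) \<Rightarrow> P ys \<and> P zs) \<and>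
        weight xs + (case y of (ys, zs) \<Rightarrow> weight ys + weight zs) = n}"
  proof -
    have "fst x \<le> n" if "x \<in> set xs" "weight xs \<le> n" for x :: part and xs
      using part_le_weight[OF that(1)] that(2) by linarith
    then show ?thesis by (fastforce simp: odd_overpartition_triples_def P_def)
  qed
  moreover have pairs: "{y. (case y of (ys, zs) \<Rightarrow> P ys \<and> P zs) \<and> (case y of (ys, zs) \<Rightarrow> weight ys + weight zs) = i}
     = {(ys, zs). P ys \<and> P zs \<and> weight ys + weight zs = i}" for i
    by auto
  have card_pairs: "card {(ys, zs). P ys \<and> P zs \<and> weight ys + weight zs = i} =
    (\<Sum>j=0..i. card (bounded_odd_overpartitions n j) * card (bounded_odd_overpartitions n (i - j)))" for i
    by (subst card_pairs_add_eq) (simp_all add: P finite_bounded_odd_overpartitions)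
  have fin_pairs: "finite {(ys, zs). P ys \<and> P zs \<and> weight ys + weight zs = i}" for i
  proof (rule finite_subset)
    show "{(ys, zs). P ys \<and> P zs \<and> weight ys + weight zs = i} \<subseteq>
      (\<Union>j\<le>i. bounded_odd_overpartitions n j) \<times> (\<Union>j\<le>i. bounded_odd_overpartitions n j)"
      by (auto simp: P[symmetric])
  qed (simp add: finite_bounded_odd_overpartitions)
  ultimately have "OPT n = (\<Sum>i=0..n. card (bounded_odd_overpartitions n i) *
      (\<Sum>j=0..n-i. card (bounded_odd_overpartitions n j) * card (bounded_odd_overpartitions n (n - i - j))))"
    unfolding OPT_def
    by (simp only:, subst card_pairs_add_eq)
      (simp_all only: P finite_bounded_odd_overpartitions pairs card_pairs fin_pairs)
  then show ?thesis by (simp add: power3_eq_cube fps_mult_nth mult.assoc)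
qed

subsection \<open>Parity of divisor counts and Zagier's involution\<close>

text \<open>The involution sending \<open>d\<close> to \<open>n div d\<close> fixes exactly the
  square roots of \<open>n\<close>.\<close>

lemma odd_card_divisors_iff:
  fixes n :: nat
  assumes "n > 0"
  shows "odd (card {d. d dvd n}) \<longleftrightarrow> (\<exists>s. n = s\<^sup>2)"
proof -
  have "even (card {d. d dvd n}) \<longleftrightarrow> even (card {d \<in> {d. d dvd n}. n div d = d})"
    using assms by (intro even_card_iff_even_card_fixpoints) (auto elim!: dvdE)
  moreover have "{d \<in> {d. d dvd n}. n div d = d} = {s. n = s\<^sup>2}"
    using assms by (auto simp: power2_eq_square elim!: dvdE)
  moreover have "card {s. n = s\<^sup>2} = (if \<exists>s. n = s\<^sup>2 then 1 else 0)"
  proof (cases "\<exists>s. n = s\<^sup>2")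
    case True
    then obtain s where "n = s\<^sup>2" by blast
    then have "{s. n = s\<^sup>2} = {s}" by (auto simp: power2_eq_iff_nonneg)
    then show ?thesis using True by simp
  qed auto
  ultimately show ?thesis by (simp split: if_splits)
qed

text \<open>For positive \<open>n\<close>, the coefficient of $q^n$ in the sum of the $x_k$ over odd
  $k$.\<close>

definition num_odd_divisors :: "nat \<Rightarrow> nat" where
  "num_odd_divisors n = card {d. odd d \<and> d dvd n}"

lemma num_odd_divisors_odd:
  assumes "odd n"
  shows "num_odd_divisors n = card {d. d dvd n}"
proof -
  have "odd d" if "d dvd n" for d using assms that dvd_trans[of 2 d n] by auto
  then have "{d. odd d \<and> d dvd n} = {d. d dvd n}" by auto
  then show ?thesis by (simp only: num_odd_divisors_def)
qed

text \<open>The odd divisors of \<open>n = 2 ^ k * w\<close> with \<open>w\<close> odd are the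
  divisors of \<open>w\<close>, so \<open>w\<close> must be a square; the parity of \<open>k\<close>
  then decides between the two shapes of \<open>n\<close>.\<close>

lemma odd_num_odd_divisors_iff:
  assumes "n > 0"
  shows "odd (num_odd_divisors n) \<longleftrightarrow> (\<exists>s. n = s\<^sup>2 \<or> n = 2 * s\<^sup>2)"
proof -
  have unique: "a = b" if "2 ^ i * a = 2 ^ j * b" "odd a" "odd b" for a b i j :: nat
  proof -
    have "coprime a (2 ^ j)" "coprime b (2 ^ i)" using that by simp_all
    moreover have "a dvd 2 ^ j * b" "b dvd 2 ^ i * a" using that by (metis dvd_triv_right)+
    ultimately show ?thesis by (meson coprime_dvd_mult_right_iff dvd_antisym)
  qed
  obtain k w where w: "n = 2 ^ k * w" "odd w"
    using multiplicity_decompose'[of n 2] assms by (metis bot_nat_0.not_eq_extremum odd_one)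
  have "{d. odd d \<and> d dvd n} = {d. d dvd w}"
  proof -
    have "d dvd n \<longleftrightarrow> d dvd w" if "odd d" for d
      using that w by (simp add: coprime_dvd_mult_right_iff)
    moreover have "odd d" if "d dvd w" for d
      using that w dvd_trans[of 2 d w] by auto
    ultimately show ?thesis by blast
  qed
  then have "odd (num_odd_divisors n) \<longleftrightarrow> (\<exists>s. w = s\<^sup>2)"
    using odd_card_divisors_iff[of w] w by (simp add: num_odd_divisors_def odd_pos)
  also have "\<dots> \<longleftrightarrow> (\<exists>s. n = s\<^sup>2 \<or> n = 2 * s\<^sup>2)"
  proof
    assume "\<exists>s. w = s\<^sup>2"
    then obtain s where s: "w = s\<^sup>2" by blast
    show "\<exists>s. n = s\<^sup>2 \<or> n = 2 * s\<^sup>2"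
    proof (cases "even k")
      case True
      then obtain j where "k = 2 * j" by blast
      then have "n = (2 ^ j * s)\<^sup>2" using w s by (simp add: power_mult_distrib power_mult mult.commute)
      then show ?thesis by blast
    next
      case False
      then obtain j where "k = 2 * j + 1" by (metis oddE)
      then have "n = 2 * (2 ^ j * s)\<^sup>2" using w s by (simp add: power_mult_distrib power_mult mult.commute)
      then show ?thesis by blast
    qed
  next
    assume "\<exists>s. n = s\<^sup>2 \<or> n = 2 * s\<^sup>2"
    \<comment> \<open>The exponent \<open>i\<close> is 0 or 1, which treats both shapes at once;
      \<open>unique\<close> then compares odd parts.\<close>
    then obtain s i where s: "n = 2 ^ i * s\<^sup>2" by (metis mult_1 power_0 power_one_right)
    then have "s > 0" using assms by (cases s) auto
    then obtain j u where u: "s = 2 ^ j * u" "odd u"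
      using multiplicity_decompose'[of s 2] by (metis bot_nat_0.not_eq_extremum odd_one)
    have "2 ^ k * w = 2 ^ (i + 2 * j) * u\<^sup>2"
      using s w u by (simp add: power_add power_mult_distrib power_mult mult.commute)
    then have "w = u\<^sup>2" using unique[of k w "i + 2 * j" "u\<^sup>2"] w u by simp
    then show "\<exists>s. w = s\<^sup>2" by blast
  qed
  finally show ?thesis .
qed

text \<open>Divisors pair off as \<open>d\<close> and \<open>N div d\<close>. The half is kept as
  the set of smaller divisors, because Zagier's involution produces the same set.\<close>

lemma num_odd_divisors_nonsquare:
  assumes "odd N" "\<And>s. N \<noteq> s\<^sup>2"
  shows "num_odd_divisors N = 2 * card {d. d dvd N \<and> d < N div d}"
proof -
  let ?L = "{d. d dvd N \<and> d < N div d}"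
  have "N > 0" using assms by (simp add: odd_pos)
  have fin: "finite ?L" using \<open>N > 0\<close> by (auto intro: finite_subset[OF _ finite_divisors_nat])
  have flip: "N div (N div d) = d" "N div d dvd N" if "d dvd N" for d
    using that \<open>N > 0\<close> by (auto elim!: dvdE)
  have "d \<noteq> N div d" if "d dvd N" for d
    using that assms(2)[of d] by (metis dvd_mult_div_cancel power2_eq_square)
  then have "d \<in> ?L \<union> (\<lambda>d. N div d) ` ?L" if "d dvd N" for d
    using flip[OF that] that by (cases "d < N div d") (auto intro!: image_eqI[of _ _ "N div d"] simp: order_less_le)
  then have "{d. d dvd N} = ?L \<union> (\<lambda>d. N div d) ` ?L"
    using flip by blast
  then have "card {d. d dvd N} = card (?L \<union> (\<lambda>d. N div d) ` ?L)" by (rule arg_cong)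
  moreover have "?L \<inter> (\<lambda>d. N div d) ` ?L = {}"
  proof -
    have "\<not> N div d < N div (N div d)" if "d \<in> ?L" for d using that flip by simp
    then show ?thesis by blast
  qed
  then have "card (?L \<union> (\<lambda>d. N div d) ` ?L) = card ?L + card ((\<lambda>d. N div d) ` ?L)"
    using fin by (intro card_Un_disjoint) simp_all
  moreover have "card ((\<lambda>d. N div d) ` ?L) = card ?L"
    by (intro card_image inj_on_inverseI[of _ "\<lambda>d. N div d"]) (simp add: flip)
  ultimately have "card {d. d dvd N} = 2 * card ?L" by linarith
  then show ?thesis using num_odd_divisors_odd[OF assms(1)] by simp
qed

text \<open>Two involutions act on the positive solutions of $x^2 + 4yz = N$. Swapping $y$ and $z$
  fixes the solutions with $y = z$; Zagier's map fixes those with $x = y$, that is the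
  factorizations $N = x(x + 4z)$.\<close>

lemma zagier_parity:
  fixes N :: nat
  assumes N: "N mod 4 = 1" and nonsquare: "\<And>s. N \<noteq> s\<^sup>2"
  shows "even (card {(x, y). x > 0 \<and> y > 0 \<and> x\<^sup>2 + 4 * y\<^sup>2 = N}) \<longleftrightarrow>
    even (card {d. d dvd N \<and> d < N div d})"
proof -
  define S where "S = {(x, y, z). x > 0 \<and> y > 0 \<and> z > 0 \<and> x\<^sup>2 + 4 * y * z = N}"
  text \<open>
    Zagier's involution. The boundary cases $y = x + z$ and $x = 2y$ would make $N$ a square or even.
  \<close>
  define f where "f = (\<lambda>(x, y, z). if x + z < y then (x + 2 * z, z, y - x - z)
    else if x < 2 * y then (2 * y - x, y, x + z - y) else (x - 2 * y, x + z - y, y :: nat))"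
  have "S \<subseteq> {..N} \<times> {..N} \<times> {..N}"
  proof
    fix t assume "t \<in> S"
    moreover obtain x y z where t: "t = (x, y, z)" by (cases t)
    ultimately have "(x, y, z) \<in> S" by simp
    then have *: "x > 0" "y > 0" "z > 0" "x * x + 4 * (y * z) = N"
      by (auto simp: S_def power2_eq_square)
    then have "x \<le> x * x" "y \<le> y * z" "z \<le> y * z" by auto
    then have "x \<le> N" "y \<le> N" "z \<le> N" using *(4) by linarith+
    then show "t \<in> {..N} \<times> {..N} \<times> {..N}" using t by simp
  qed
  then have fin: "finite S" by (rule finite_subset) simp
  have bd: "x + z \<noteq> y" "x \<noteq> 2 * y" if "(x, y, z) \<in> S" for x y z
  proof -
    show "x + z \<noteq> y"
    proof
      assume "x + z = y"
      then have "N = (y + z)\<^sup>2" using that by (auto simp: S_def power2_eq_square algebra_simps)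
      then show False using nonsquare by blast
    qed
    show "x \<noteq> 2 * y"
    proof
      assume "x = 2 * y"
      then have "N = 4 * (y\<^sup>2 + y * z)" using that by (auto simp: S_def power2_eq_square algebra_simps)
      then show False using N by presburger
    qed
  qed
  have "even (card S) \<longleftrightarrow> even (card {t \<in> S. f t = t})"
  proof (rule even_card_iff_even_card_fixpoints[OF fin])
    fix t assume t: "t \<in> S"
    obtain x y z where [simp]: "t = (x, y, z)" by (cases t)
    have b: "x + z \<noteq> y" "x \<noteq> 2 * y" "x > 0" "y > 0" "z > 0" "x\<^sup>2 + 4 * y * z = N"
      using bd[of x y z] t by (simp_all add: S_def)
    \<comment> \<open>On \<open>S\<close> the first and third branches of \<open>f\<close> are
      inverse to each other and the middle branch is its own inverse.\<close>
    show "f (f t) = t" using b by (auto simp: f_def)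
    consider "x + z < y" | "y < x + z" "x < 2 * y" | "y < x + z" "2 * y < x" using b by linarith
    then show "f t \<in> S"
    proof cases
      case 1
      \<comment> \<open>In \<open>int\<close> the truncated differences become genuine ones, and the
        invariance of the form is a polynomial identity.\<close>
      have "int ((x + 2 * z)\<^sup>2 + 4 * z * (y - x - z)) = int (x\<^sup>2 + 4 * y * z)"
      proof -
        have "int (y - x - z) = int y - int x - int z" using 1 by auto
        then show ?thesis
          by (simp only: of_nat_add of_nat_mult of_nat_power of_nat_numeral)
            (simp add: power2_eq_square algebra_simps)
      qed
      then show ?thesis using 1 b by (simp only: of_nat_eq_iff) (simp add: S_def f_def)
    next
      case 2
      have "int ((2 * y - x)\<^sup>2 + 4 * y * (x + z - y)) = int (x\<^sup>2 + 4 * y * z)"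
      proof -
        have "int (2 * y - x) = 2 * int y - int x" "int (x + z - y) = int x + int z - int y" using 2 by auto
        then show ?thesis
          by (simp only: of_nat_add of_nat_mult of_nat_power of_nat_numeral)
            (simp add: power2_eq_square algebra_simps)
      qed
      then show ?thesis using 2 b by (simp only: of_nat_eq_iff) (simp add: S_def f_def)
    next
      case 3
      have "int ((x - 2 * y)\<^sup>2 + 4 * (x + z - y) * y) = int (x\<^sup>2 + 4 * y * z)"
      proof -
        have "int (x - 2 * y) = int x - 2 * int y" "int (x + z - y) = int x + int z - int y" using 3 by auto
        then show ?thesis
          by (simp only: of_nat_add of_nat_mult of_nat_power of_nat_numeral)
            (simp add: power2_eq_square algebra_simps)
      qed
      then show ?thesis using 3 b by (simp only: of_nat_eq_iff) (simp add: S_def f_def)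
    qed
  qed
  also have "{t \<in> S. f t = t} = {(x, y, z). (x, y, z) \<in> S \<and> x = y}"
  proof -
    \<comment> \<open>The outer branches change the first coordinate; the middle one keeps it only
      if \<open>2 * y - x = x\<close>.\<close>
    have "f (x, y, z) = (x, y, z) \<longleftrightarrow> x = y" if "(x, y, z) \<in> S" for x y z
      using bd[OF that] that by (auto simp: f_def S_def)
    then show ?thesis by auto
  qed
  also have "card \<dots> = card {d. d dvd N \<and> d < N div d}"
  proof (rule bij_betw_same_card[of fst], unfold bij_betw_def, intro conjI inj_onI equalityI subsetI)
    fix t u assume "t \<in> {(x, y, z). (x, y, z) \<in> S \<and> x = y}" "u \<in> {(x, y, z). (x, y, z) \<in> S \<and> x = y}"
      "fst t = fst u"
    then show "t = u" by (auto simp: S_def)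
  next
    fix d assume "d \<in> fst ` {(x, y, z). (x, y, z) \<in> S \<and> x = y}"
    then obtain z where "d > 0" "z > 0" "N = d * (d + 4 * z)"
      by (auto simp: S_def power2_eq_square algebra_simps)
    then show "d \<in> {d. d dvd N \<and> d < N div d}" by simp
  next
    fix d assume "d \<in> {d. d dvd N \<and> d < N div d}"
    then obtain e where e: "N = d * e" "d < e" "d > 0" using N by (auto elim!: dvdE) (cases d; auto)
    \<comment> \<open>Each unit modulo 4 is its own inverse, so \<open>d * e\<close> being 1 forces
      equal residues.\<close>
    have "d mod 4 = e mod 4"
    proof -
      have "(d mod 4) * (e mod 4) mod 4 = 1" using N e by (simp add: mod_mult_eq)
      moreover have "d mod 4 \<in> {0,1,2,3}" "e mod 4 \<in> {0,1,2,3}" by auto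
      ultimately show ?thesis by auto
    qed
    then obtain z where z: "e = d + 4 * z" using \<open>d < e\<close>
      by (metis less_imp_le mod_eq_dvd_iff_nat dvdE le_add_diff_inverse)
    then have "(d, d, z) \<in> S" using e by (auto simp: S_def power2_eq_square algebra_simps)
    then show "d \<in> fst ` {(x, y, z). (x, y, z) \<in> S \<and> x = y}" by force
  qed
  finally have "even (card S) \<longleftrightarrow> even (card {d. d dvd N \<and> d < N div d})" .
  moreover have "even (card S) \<longleftrightarrow> even (card {t \<in> S. (\<lambda>(x, y, z). (x, z, y)) t = t})"
    by (rule even_card_iff_even_card_fixpoints[OF fin]) (auto simp: S_def algebra_simps)
  moreover have "{t \<in> S. (\<lambda>(x, y, z). (x, z, y)) t = t} =
      (\<lambda>(x, y). (x, y, y)) ` {(x, y). x > 0 \<and> y > 0 \<and> x\<^sup>2 + 4 * y\<^sup>2 = N}"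
    by (auto simp: S_def power2_eq_square image_iff)
  moreover have "inj (\<lambda>(x :: nat, y :: nat). (x, y, y))" by (auto simp: inj_def)
  ultimately show ?thesis by (simp add: card_image inj_on_subset)
qed

text \<open>In an odd summand both arguments are squares or doubled squares. The odd number
  \<open>N - m\<close> is then a square, and \<open>m\<close> cannot be a doubled square by
  hypothesis, so \<open>m = (2 * y)\<^sup>2\<close>: odd summands match solutions of $x^2 + 4y^2 =
  N$.\<close>

lemma odd_divisor_convolution_parity:
  assumes "N mod 4 = 1" "\<And>x y. x\<^sup>2 + 2 * y\<^sup>2 \<noteq> N"
  shows "even (\<Sum>m | 0 < m \<and> m < N \<and> even m. num_odd_divisors m * num_odd_divisors (N - m)) \<longleftrightarrow>
    even (card {d. d dvd N \<and> d < N div d})"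
proof -
  let ?A = "{m. 0 < m \<and> m < N \<and> even m}"
  let ?R = "{(x, y). x > 0 \<and> y > 0 \<and> x\<^sup>2 + 4 * y\<^sup>2 = N}"
  have "odd N" using assms(1) by presburger
  have nonsquare: "N \<noteq> s\<^sup>2" for s using assms(2)[of s 0] by simp
  have "{m \<in> ?A. odd (num_odd_divisors m * num_odd_divisors (N - m))} = (\<lambda>(x, y). 4 * y\<^sup>2) ` ?R"
  proof (intro equalityI subsetI)
    fix m assume "m \<in> {m \<in> ?A. odd (num_odd_divisors m * num_odd_divisors (N - m))}"
    then have m: "0 < m" "m < N" "even m" and "odd (num_odd_divisors m)" "odd (num_odd_divisors (N - m))"
      by auto
    then have squares: "\<exists>s. m = s\<^sup>2 \<or> m = 2 * s\<^sup>2" "\<exists>s. N - m = s\<^sup>2 \<or> N - m = 2 * s\<^sup>2"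
      using odd_num_odd_divisors_iff[of m] odd_num_odd_divisors_iff[of "N - m"] by simp_all
    have "odd (N - m)" using m \<open>odd N\<close> by simp
    then obtain t where t: "N - m = t\<^sup>2" using squares(2) by fastforce
    then have Nt: "N = t\<^sup>2 + m" using m by simp
    then obtain s where s: "m = s\<^sup>2" using squares(1) assms(2) by blast
    then obtain y where y: "s = 2 * y" using m(3) by auto
    have "(t, y) \<in> ?R" using Nt s y m by (auto simp: power_mult_distrib intro!: gr0I)
    then show "m \<in> (\<lambda>(x, y). 4 * y\<^sup>2) ` ?R" using s y by (force simp: power_mult_distrib)
  next
    fix m assume "m \<in> (\<lambda>(x, y). 4 * y\<^sup>2) ` ?R"
    then obtain x y where xy: "x > 0" "y > 0" "x\<^sup>2 + 4 * y\<^sup>2 = N" "m = 4 * y\<^sup>2" by auto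
    then have "m = (2 * y)\<^sup>2" "N - m = x\<^sup>2" by (auto simp: power_mult_distrib)
    moreover have "0 < m" "m < N" "even m" using xy by auto
    ultimately show "m \<in> {m \<in> ?A. odd (num_odd_divisors m * num_odd_divisors (N - m))}"
      using odd_num_odd_divisors_iff[of m] odd_num_odd_divisors_iff[of "N - m"] by fastforce
  qed
  moreover have "inj_on (\<lambda>(x, y). 4 * y\<^sup>2) ?R"
    by (auto simp: inj_on_def power2_eq_iff_nonneg)
  ultimately have "card {m \<in> ?A. odd (num_odd_divisors m * num_odd_divisors (N - m))} = card ?R"
    by (simp add: card_image)
  then show ?thesis using zagier_parity[OF assms(1) nonsquare] by (simp add: even_sum_iff)
qed

text \<open>Since \<open>d\<close> and \<open>N div d\<close> agree modulo 4, a summand is 0 or 2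
  modulo 4 as \<open>d\<close> is 1 or 3. The divisors that are 3 modulo 4 are paired by
  \<open>N div d\<close>, without fixed points.\<close>

lemma codivisor_sum_mod4:
  assumes N: "N mod 4 = 1" and nonsquare: "\<And>s. N \<noteq> s\<^sup>2"
  shows "4 dvd (\<Sum>d | d dvd N. int (N div d) - 1)"
proof -
  have "N > 0" using N by (auto intro: gr0I)
  then have fin: "finite {d. d dvd N}" by simp
  have res: "d mod 4 = N div d mod 4" "odd d" if "d dvd N" for d
  proof -
    obtain e where e: "N = d * e" using \<open>d dvd N\<close> by blast
    then have "(d mod 4) * (e mod 4) mod 4 = 1" using N by (simp add: mod_mult_eq)
    moreover have "d mod 4 \<in> {0,1,2,3}" "e mod 4 \<in> {0,1,2,3}" by auto
    moreover have "N div d = e" using e \<open>N > 0\<close> by simp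
    ultimately show "d mod 4 = N div d mod 4" by auto
    have "odd N" using N by presburger
    then show "odd d" using e by simp
  qed
  have "[(\<Sum>d | d dvd N. int (N div d) - 1) = (\<Sum>d | d dvd N. if d mod 4 = 3 then 2 else 0)] (mod 4)"
  proof (rule cong_sum)
    fix d assume "d \<in> {d. d dvd N}"
    then have d: "d mod 4 = N div d mod 4" "odd d" using res by auto
    have "d mod 4 = 3 \<or> d mod 4 = 1" using d(2) by presburger
    moreover have "int (N div d) mod 4 = int (d mod 4)" using d(1) by (simp add: zmod_int)
    ultimately have "d mod 4 = 3 \<and> int (N div d) mod 4 = 3 \<or> d mod 4 = 1 \<and> int (N div d) mod 4 = 1"
      by auto
    then have "(int (N div d) - 1) mod 4 = (if d mod 4 = 3 then 2 else 0)"
      by (elim disjE conjE; simp add: mod_diff_left_eq[symmetric])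
    then show "[int (N div d) - 1 = (if d mod 4 = 3 then 2 else 0)] (mod 4)"
      unfolding cong_def by simp
  qed
  also have "(\<Sum>d | d dvd N. if d mod 4 = 3 then 2 else 0) = 2 * int (card {d. d dvd N \<and> d mod 4 = 3})"
    using fin by (simp flip: sum.inter_filter)
  finally have "[(\<Sum>d | d dvd N. int (N div d) - 1) = 2 * int (card {d. d dvd N \<and> d mod 4 = 3})] (mod 4)" .
  moreover have "even (card {d. d dvd N \<and> d mod 4 = 3})"
  proof -
    have fixpoints: "even (card {d. d dvd N \<and> d mod 4 = 3}) \<longleftrightarrow>
        even (card {d \<in> {d. d dvd N \<and> d mod 4 = 3}. N div d = d})"
    proof (rule even_card_iff_even_card_fixpoints)
      show "finite {d. d dvd N \<and> d mod 4 = 3}" by (rule finite_subset[OF _ fin]) auto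
    next
      fix d assume "d \<in> {d. d dvd N \<and> d mod 4 = 3}"
      then have "d dvd N" "N div d mod 4 = 3" using res(1)[of d] by simp_all
      then show "N div d \<in> {d. d dvd N \<and> d mod 4 = 3}" "N div (N div d) = d"
        using \<open>N > 0\<close> by (auto elim!: dvdE)
    qed
    have "N div d \<noteq> d" if "d dvd N" for d
      using that nonsquare[of d] by (metis dvd_mult_div_cancel power2_eq_square)
    then have "{d \<in> {d. d dvd N \<and> d mod 4 = 3}. N div d = d} = {}" by auto
    then show ?thesis using fixpoints by (simp only: card.empty dvd_0_right)
  qed
  then have "4 dvd 2 * int (card {d. d dvd N \<and> d mod 4 = 3})" by presburger
  ultimately show ?thesis by (simp add: cong_dvd_iff)
qed

section \<open>Numbers containing a prime to an odd power\<close>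

lemma odd_multiplicity_not_square:
  fixes p m s :: nat
  assumes "prime p" "\<not> p dvd m"
  shows "p ^ (2 * k + 1) * m \<noteq> s\<^sup>2"
proof
  assume eq: "p ^ (2 * k + 1) * m = s\<^sup>2"
  have pos: "m \<noteq> 0" "p \<noteq> 0" using assms by (auto intro!: gr0I)
  then have "s \<noteq> 0" using eq by (metis mult_eq_0_iff power_eq_0_iff zero_neq_numeral power_zero_numeral)
  have "multiplicity p (p ^ (2 * k + 1) * m) = 2 * k + 1"
    using assms pos by (simp add: prime_elem_multiplicity_mult_distrib not_dvd_imp_multiplicity_0
        multiplicity_same_power prime_gt_1_nat del: power_Suc)
  moreover have "multiplicity p (s\<^sup>2) = 2 * multiplicity p s"
    using assms \<open>s \<noteq> 0\<close> by (simp add: prime_elem_multiplicity_power_distrib)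
  ultimately have "2 * k + 1 = 2 * multiplicity p s" using eq by simp
  then show False by presburger
qed

text \<open>Descent: as -2 is a nonresidue, \<open>p\<close> divides
  \<open>x\<^sup>2 + 2 * y\<^sup>2\<close> only if it divides both \<open>x\<close> and
  \<open>y\<close>. Cancelling $p^2$ lowers the odd exponent by two, and at exponent 1 it would make
  \<open>p\<close> divide \<open>m\<close>.\<close>

lemma odd_multiplicity_not_square_plus_double_square:
  fixes p m x y :: nat
  assumes p: "prime p" "\<not> QuadRes (int p) (- 2)" and m: "\<not> p dvd m"
  shows "x\<^sup>2 + 2 * y\<^sup>2 \<noteq> p ^ (2 * k + 1) * m"
proof -
  have dvd: "p dvd x \<and> p dvd y" if "p dvd x\<^sup>2 + 2 * y\<^sup>2" for x y
  proof -
    have "p dvd y"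
    proof (rule ccontr)
      assume "\<not> p dvd y"
      then have "coprime (int y) (int p)" using p by (simp add: prime_imp_coprime coprime_commute)
      then obtain u where u: "[int y * u = 1] (mod int p)" using cong_solve_coprime_int by blast
      have "int p dvd int (x\<^sup>2 + 2 * y\<^sup>2)" using that by (simp only: int_dvd_int_iff)
      then have "[(int x)\<^sup>2 + 2 * (int y)\<^sup>2 = 0] (mod int p)" by (simp add: cong_0_iff)
      \<comment> \<open>With \<open>u\<close> inverse to \<open>y\<close> modulo \<open>p\<close>,
        this exhibits \<open>x * u\<close> as a square root of -2.\<close>
      then have "[((int x)\<^sup>2 + 2 * (int y)\<^sup>2) * u\<^sup>2 - 2 * (int y * u)\<^sup>2 = 0 * u\<^sup>2 - 2 * 1\<^sup>2] (mod int p)"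
        using u by (intro cong_diff cong_mult cong_pow cong_refl)
      moreover have "((int x)\<^sup>2 + 2 * (int y)\<^sup>2) * u\<^sup>2 - 2 * (int y * u)\<^sup>2 = (int x * u)\<^sup>2"
        by (simp add: algebra_simps power_mult_distrib)
      ultimately show False using p unfolding QuadRes_def by auto
    qed
    moreover from this have "p dvd x\<^sup>2"
      using that by (metis dvd_add_left_iff dvd_mult dvd_power_iff_le dvd_power dvd_trans zero_less_numeral)
    ultimately show ?thesis using p prime_dvd_power by blast
  qed
  have reduce: "\<exists>a b. p * (a\<^sup>2 + 2 * b\<^sup>2) = n" if "x\<^sup>2 + 2 * y\<^sup>2 = p * n" for x y n
  proof -
    have "p dvd x" "p dvd y" using dvd[of x y] that by simp_all
    then obtain a b where "x = p * a" "y = p * b" by blast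
    then have "p * (p * (a\<^sup>2 + 2 * b\<^sup>2)) = p * n"
      using that by (simp add: algebra_simps power_mult_distrib power2_eq_square)
    then show ?thesis using p by (auto simp: prime_gt_0_nat)
  qed
  show ?thesis
  proof (induction k arbitrary: x y)
    case 0
    show ?case using reduce[of x y m] m by auto
  next
    case (Suc k)
    show ?case
    proof
      assume "x\<^sup>2 + 2 * y\<^sup>2 = p ^ (2 * Suc k + 1) * m"
      then have "x\<^sup>2 + 2 * y\<^sup>2 = p * (p * (p ^ (2 * k + 1) * m))" by simp
      then obtain a b where "p * (a\<^sup>2 + 2 * b\<^sup>2) = p * (p ^ (2 * k + 1) * m)" using reduce by blast
      then have "a\<^sup>2 + 2 * b\<^sup>2 = p ^ (2 * k + 1) * m" using p by (simp add: prime_gt_0_nat)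
      then show False using Suc by blast
    qed
  qed
qed

subsection \<open>The generating function modulo 8\<close>

lemma multiples_fps_sum_nth:
  assumes "0 < i" "i \<le> N"
  shows "(\<Sum>k | odd k \<and> k \<le> N. multiples_fps k) $ i = int (num_odd_divisors i)"
proof -
  have "(\<Sum>k | odd k \<and> k \<le> N. multiples_fps k) $ i = int (card {k \<in> {k. odd k \<and> k \<le> N}. k dvd i})"
    using assms by (simp add: fps_sum_nth multiples_fps_def flip: sum.inter_filter)
  also have "{k \<in> {k. odd k \<and> k \<le> N}. k dvd i} = {d. odd d \<and> d dvd i}"
    using assms by (auto dest: dvd_imp_le)
  finally show ?thesis by (simp add: num_odd_divisors_def)
qed

text \<open>The coefficient counts ordered ways to write \<open>N div k\<close> as a sum of two
  positive integers.\<close>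

lemma multiples_fps_square_nth:
  assumes "N > 0"
  shows "((multiples_fps k)\<^sup>2) $ N = (if k dvd N then int (N div k) - 1 else 0)"
proof -
  have "((multiples_fps k)\<^sup>2) $ N = (\<Sum>i=0..N. if 0 < i \<and> i < N \<and> k dvd i \<and> k dvd N - i then 1 else 0)"
    unfolding power2_eq_square fps_mult_nth by (intro sum.cong) (auto simp: multiples_fps_def)
  also have "\<dots> = int (card {i \<in> {0..N}. 0 < i \<and> i < N \<and> k dvd i \<and> k dvd N - i})"
    by (simp flip: sum.inter_filter)
  also have "{i \<in> {0..N}. 0 < i \<and> i < N \<and> k dvd i \<and> k dvd N - i} =
      (if k dvd N then (\<lambda>j. k * j) ` {0<..<N div k} else {})"
  proof (cases "k dvd N")
    case True
    then obtain e where "N = k * e" by blast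
    then show ?thesis using assms by auto
  next
    case False
    then have "\<not> k dvd N - i" if "k dvd i" "i < N" for i
      using that dvd_diffD[of k N i] by auto
    then show ?thesis using False by auto
  qed
  also have "int (card \<dots>) = (if k dvd N then int (N div k) - 1 else 0)"
  proof (cases "k dvd N")
    case True
    then have "k > 0" "N div k > 0" using assms by (auto elim!: dvdE)
    then show ?thesis using True by (simp add: card_image inj_on_def of_nat_diff)
  qed simp
  finally show ?thesis .
qed

text \<open>Cubing \<open>1 + 2 * c\<close> leaves the terms \<open>6 * c + 12 * c\<^sup>2\<close>
  modulo 8 apart from the constant, which does not reach the coefficient of the positive
  \<open>N\<close>.\<close>

lemma OPT_formula:
  assumes "odd N"
  shows "\<exists>w. int (OPT N) = 6 * int (num_odd_divisors N)
    + 36 * int (\<Sum>m | 0 < m \<and> m < N \<and> even m. num_odd_divisors m * num_odd_divisors (N - m))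
    - 6 * (\<Sum>d | d dvd N. int (N div d) - 1) + 8 * w"
proof -
  let ?A = "{k. odd k \<and> k \<le> N}"
  have "N > 0" using assms by (simp add: odd_pos)
  define S where "S = (\<Sum>k\<in>?A. multiples_fps k)"
  define T where "T = (\<Sum>k\<in>?A. (multiples_fps k)\<^sup>2)"
  have "finite ?A" by simp
  from prod_one_plus_double[OF this, of multiples_fps] obtain e z where
    e: "bounded_fps N = 1 + 2 * S + 4 * e + 8 * z" "S\<^sup>2 = T + 2 * e"
    unfolding bounded_fps_eq_prod S_def T_def by blast
  define g where "g = e + 2 * z"
  define c where "c = S + 2 * g"
  \<comment> \<open>All terms with a visible factor 8 are gathered here; the rest of
    \<open>g\<close> contributes only \<open>12 * e\<close>.\<close>
  define w where "w = 3 * z + 6 * (S * g) + 6 * g\<^sup>2 + c ^ 3"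
  have "bounded_fps N = 1 + 2 * c" using e by (simp add: c_def g_def algebra_simps)
  then have "bounded_fps N ^ 3 = 1 + 6 * c + 12 * c\<^sup>2 + 8 * c ^ 3"
    by (simp add: power3_eq_cube power2_eq_square algebra_simps)
  also have "\<dots> = 1 + 6 * S + 12 * S\<^sup>2 + 6 * (2 * e) + 8 * w"
    by (simp add: w_def c_def g_def power2_eq_square algebra_simps)
  \<comment> \<open>This trades \<open>e\<close> for series whose coefficients are divisor
    sums.\<close>
  also have "2 * e = S\<^sup>2 - T" using e by simp
  also have "1 + 6 * S + 12 * S\<^sup>2 + 6 * (S\<^sup>2 - T) + 8 * w = 1 + 6 * S + 18 * S\<^sup>2 - 6 * T + 8 * w"
    by (simp add: algebra_simps)
  finally have "int (OPT N) = 6 * S $ N + 18 * (S\<^sup>2) $ N - 6 * T $ N + 8 * w $ N"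
    using \<open>N > 0\<close> by (simp add: OPT_eq_fps_nth numeral_fps_const)
  moreover have S: "S $ i = int (num_odd_divisors i)" if "0 < i" "i \<le> N" for i
    unfolding S_def using that by (rule multiples_fps_sum_nth)
  moreover have "(S\<^sup>2) $ N =
    2 * int (\<Sum>m | 0 < m \<and> m < N \<and> even m. num_odd_divisors m * num_odd_divisors (N - m))"
  proof -
    let ?E = "{m. 0 < m \<and> m < N \<and> even m}" and ?O = "{m. 0 < m \<and> m < N \<and> odd m}"
    let ?f = "\<lambda>m. num_odd_divisors m * num_odd_divisors (N - m)"
    have "S $ 0 = 0" by (simp add: S_def fps_sum_nth multiples_fps_def)
    then have "(S\<^sup>2) $ N = (\<Sum>i\<in>{0<..<N}. S $ i * S $ (N - i))"
      unfolding power2_eq_square fps_mult_nth by (intro sum.mono_neutral_right) auto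
    also have "\<dots> = (\<Sum>i\<in>{0<..<N}. int (?f i))" by (intro sum.cong) (auto simp: S)
    also have "\<dots> = int (sum ?f {0<..<N})" by simp
    also have "{0<..<N} = ?E \<union> ?O" by auto
    also have "sum ?f (?E \<union> ?O) = sum ?f ?E + sum ?f ?O" by (intro sum.union_disjoint) auto
    \<comment> \<open>For odd \<open>N\<close>, replacing \<open>m\<close> by \<open>N - m\<close>
      exchanges even and odd indices; the resulting factor 2 turns 18 into 36.\<close>
    also have "sum ?f ?O = sum ?f ?E"
      using assms by (intro sum.reindex_bij_witness[of _ "\<lambda>m. N - m" "\<lambda>m. N - m"]) auto
    finally show ?thesis by simp
  qed
  moreover have "T $ N = (\<Sum>d | d dvd N. int (N div d) - 1)"
  proof -
    have "T $ N = (\<Sum>k\<in>?A. if k dvd N then int (N div k) - 1 else 0)"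
      using \<open>N > 0\<close> by (simp add: T_def fps_sum_nth multiples_fps_square_nth)
    also have "\<dots> = (\<Sum>k\<in>{k \<in> ?A. k dvd N}. int (N div k) - 1)"
      by (rule sum.inter_filter[symmetric]) simp
    also have "{k \<in> ?A. k dvd N} = {d. d dvd N}"
      using assms \<open>N > 0\<close> dvd_trans[of 2 _ N] by (auto dest: dvd_imp_le)
    finally show ?thesis .
  qed
  ultimately show ?thesis using S[of N] \<open>N > 0\<close> by (intro exI[of _ "w $ N"]) simp
qed

text \<open>All codivisors of an odd number are odd, so the last sum in \<open>OPT_formula\<close>
  is even, as is the divisor count; both have coefficient 6 or -6.\<close>

lemma OPT_mod4:
  assumes "odd N" "\<And>s. N \<noteq> s\<^sup>2"
  shows "[OPT N = 0] (mod 4)"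
proof -
  have "even (int (N div d) - 1)" if "d dvd N" for d
  proof -
    have "N = d * (N div d)" using that by simp
    then have "odd (N div d)" using assms(1) by (metis even_mult_iff)
    then show ?thesis by simp
  qed
  then have "even (\<Sum>d | d dvd N. int (N div d) - 1)" by (intro dvd_sum) simp
  then obtain b where "(\<Sum>d | d dvd N. int (N div d) - 1) = 2 * b" by blast
  moreover obtain w where "int (OPT N) = 6 * int (num_odd_divisors N)
    + 36 * int (\<Sum>m | 0 < m \<and> m < N \<and> even m. num_odd_divisors m * num_odd_divisors (N - m))
    - 6 * (\<Sum>d | d dvd N. int (N div d) - 1) + 8 * w"
    using OPT_formula[OF assms(1)] by blast
  moreover have "num_odd_divisors N = 2 * card {d. d dvd N \<and> d < N div d}"
    using assms by (rule num_odd_divisors_nonsquare)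
  moreover have "4 dvd x" if "s = 2 * b" "x = 6 * int n + 36 * int q - 6 * s + 8 * w" "n = 2 * l"
    for x s w b :: int and n q l :: nat
    using that by presburger
  ultimately have "4 dvd int (OPT N)" by blast
  then show ?thesis by (simp add: cong_0_iff int_dvd_int_iff[of 4, simplified])
qed

text \<open>With \<open>l\<close> half the divisor count and \<open>q\<close> the convolution,
  \<open>12 * l + 36 * q = 12 * (l + 3 * q)\<close> is divisible by 8 because \<open>l\<close> and
  \<open>q\<close> have equal parity; the divisor sum contributes a multiple of 24.\<close>

lemma OPT_mod8:
  assumes "N mod 4 = 1" "\<And>x y. x\<^sup>2 + 2 * y\<^sup>2 \<noteq> N"
  shows "[OPT N = 0] (mod 8)"
proof -
  have N: "odd N" "N \<noteq> s\<^sup>2" for s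
    using assms(1) assms(2)[of s 0] by (presburger, simp)
  obtain b where "(\<Sum>d | d dvd N. int (N div d) - 1) = 4 * b"
    using codivisor_sum_mod4[OF assms(1) N(2)] by blast
  moreover obtain w where "int (OPT N) = 6 * int (num_odd_divisors N)
    + 36 * int (\<Sum>m | 0 < m \<and> m < N \<and> even m. num_odd_divisors m * num_odd_divisors (N - m))
    - 6 * (\<Sum>d | d dvd N. int (N div d) - 1) + 8 * w"
    using OPT_formula[OF N(1)] by blast
  moreover have "num_odd_divisors N = 2 * card {d. d dvd N \<and> d < N div d}"
    using N by (rule num_odd_divisors_nonsquare)
  moreover note odd_divisor_convolution_parity[OF assms]
  moreover have "8 dvd x" if "s = 4 * b" "x = 6 * int n + 36 * int q - 6 * s + 8 * w" "n = 2 * l"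
      "even q \<longleftrightarrow> even l"
    for x s w b :: int and n q l :: nat
    using that by presburger
  ultimately have "8 dvd int (OPT N)" by blast
  then show ?thesis by (simp add: cong_0_iff int_dvd_int_iff[of 8, simplified])
qed

section \<open>The arguments in the two arithmetic progressions\<close>

lemma factor_progression:
  fixes p :: nat
  shows "c * a * p ^ (2 * k + 1) * b + a * p ^ (2 * (k + 1)) = p ^ (2 * k + 1) * (a * (c * b + p))"
proof -
  have "c * a * P * b + a * (P * p) = P * (a * (c * b + p))" for P
    by (simp add: algebra_simps)
  moreover have "p ^ (2 * (k + 1)) = p ^ (2 * k + 1) * p" by simp
  ultimately show ?thesis by (simp only:)
qed

text \<open>Modulo \<open>p\<close> the expression is \<open>c * t\<close>, a product of two numbers
  prime to \<open>p\<close>. Hence the power split off in \<open>factor_progression\<close> is the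
  full power of \<open>p\<close>, up to the factor \<open>a\<close>.\<close>

lemma prime_not_dvd_progression:
  fixes p c n t :: nat
  assumes "prime p" "\<not> p dvd c" "t \<in> {1..p - 1}"
  shows "\<not> p dvd c * (p * n + t) + p"
proof -
  have "\<not> p dvd t" using assms(3) by (auto dest: dvd_imp_le)
  then have "\<not> p dvd c * t" using assms by (simp add: prime_dvd_mult_iff)
  moreover have "c * (p * n + t) + p = p * (c * n + 1) + c * t" by (simp add: algebra_simps)
  ultimately show ?thesis by (simp only: dvd_add_right_iff dvd_triv_left not_False_eq_True)
qed

lemma prime_not_dvd_power:
  fixes p q :: nat
  assumes "prime p" "q < p" "q > 0"
  shows "\<not> p dvd q ^ k"
  using assms prime_dvd_power[of p q k] nat_dvd_not_less[of q p] by blast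

theorem theorem2p5:
  shows "(\<forall>p::nat. prime p \<and> p \<ge> 3 \<longrightarrow>
           (\<forall>(n::nat) (\<alpha>::nat) (\<delta>::nat). \<forall>t\<in>{1..p - 1}.
              [OPT (2 * 3 ^ (2 * \<alpha>) * p ^ (2 * \<delta> + 1) * (p * n + t)
                    + 3 ^ (2 * \<alpha>) * p ^ (2 * (\<delta> + 1))) = 0] (mod 4)))
       \<and> (\<forall>p::nat. prime p \<and> p > 3 \<and> Legendre (- 2) (int p) = - 1 \<longrightarrow>
           (\<forall>(n::nat) (\<alpha>::nat) (\<delta>::nat). \<forall>r\<in>{1..p - 1}.
              [OPT (8 * 3 ^ (2 * \<alpha>) * p ^ (2 * \<delta> + 1) * (p * n + r)
                    + 3 ^ (2 * \<alpha>) * p ^ (2 * (\<delta> + 1))) = 0] (mod 8)))"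
proof (intro conjI allI impI ballI)
  fix p n \<alpha> \<delta> t :: nat
  assume p: "prime p \<and> p \<ge> 3" and t: "t \<in> {1..p - 1}"
  define m where "m = 2 * (p * n + t) + p"
  have "odd p" using p prime_odd_nat[of p] by auto
  then have odd: "odd (p ^ (2 * \<delta> + 1) * (3 ^ (2 * \<alpha>) * m))" by (simp add: m_def)
  have m: "\<not> p dvd m"
    unfolding m_def using p t prime_not_dvd_power[of p 2 1] by (intro prime_not_dvd_progression) auto
  have nonsquare: "p ^ (2 * \<delta> + 1) * (3 ^ (2 * \<alpha>) * m) \<noteq> s\<^sup>2" for s
  proof (cases "p = 3")
    \<comment> \<open>Here \<open>3 ^ (2 * \<alpha>)\<close> is itself a power of \<open>p\<close>;
      its even exponent keeps the total exponent odd.\<close>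
    case True
    have "p ^ (2 * \<delta> + 1) * (3 ^ (2 * \<alpha>) * m) = p ^ (2 * (\<alpha> + \<delta>) + 1) * m"
      by (simp add: True power_add distrib_left)
    then show ?thesis using odd_multiplicity_not_square[of p m "\<alpha> + \<delta>" s] p m by metis
  next
    case False
    then have "\<not> p dvd 3 ^ (2 * \<alpha>) * m"
      using p m prime_not_dvd_power[of p 3] by (simp add: prime_dvd_mult_iff)
    then show ?thesis using p by (intro odd_multiplicity_not_square) auto
  qed
  show "[OPT (2 * 3 ^ (2 * \<alpha>) * p ^ (2 * \<delta> + 1) * (p * n + t)
      + 3 ^ (2 * \<alpha>) * p ^ (2 * (\<delta> + 1))) = 0] (mod 4)"
    using OPT_mod4[OF odd nonsquare] unfolding factor_progression m_def .
next
  fix p n \<alpha> \<delta> r :: nat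
  assume p: "prime p \<and> p > 3 \<and> Legendre (- 2) (int p) = - 1" and r: "r \<in> {1..p - 1}"
  define m where "m = 8 * (p * n + r) + p"
  let ?N = "p ^ (2 * \<delta> + 1) * (3 ^ (2 * \<alpha>) * m)"
  have "odd p" using p prime_odd_nat[of p] by auto
  have "\<not> p dvd m"
    unfolding m_def using p r prime_not_dvd_power[of p 2 3] by (intro prime_not_dvd_progression) auto
  then have m: "\<not> p dvd 3 ^ (2 * \<alpha>) * m"
    using p prime_not_dvd_power[of p 3] by (simp add: prime_dvd_mult_iff)
  have nonresidue: "\<not> QuadRes (int p) (- 2)"
    using p by (auto simp: Legendre_def split: if_splits)
  have "odd (3 ^ \<alpha> * p ^ (\<delta> + 1))" using \<open>odd p\<close> by simp
  then obtain j where j: "3 ^ \<alpha> * p ^ (\<delta> + 1) = 2 * j + 1" by (elim oddE)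
  \<comment> \<open>The argument is a multiple of 8 plus an odd square, hence 1 modulo 4.\<close>
  have "?N = 8 * (p ^ (2 * \<delta> + 1) * 3 ^ (2 * \<alpha>) * (p * n + r)) + (3 ^ \<alpha> * p ^ (\<delta> + 1))\<^sup>2"
  proof -
    have "(3 ^ \<alpha> * p ^ (\<delta> + 1))\<^sup>2 = 3 ^ (2 * \<alpha>) * (p ^ (2 * \<delta> + 1) * p)"
      by (simp only: power_mult_distrib power_mult[symmetric] mult.commute[of _ 2]) simp
    then show ?thesis by (simp only: m_def) (simp add: distrib_left)
  qed
  also have "(3 ^ \<alpha> * p ^ (\<delta> + 1))\<^sup>2 = 4 * (j\<^sup>2 + j) + 1"
    unfolding j by (simp add: power2_eq_square algebra_simps)
  finally have mod4: "?N mod 4 = 1" by presburger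
  have "x\<^sup>2 + 2 * y\<^sup>2 \<noteq> ?N" for x y
    using p nonresidue m by (intro odd_multiplicity_not_square_plus_double_square) auto
  from OPT_mod8[OF mod4 this]
  show "[OPT (8 * 3 ^ (2 * \<alpha>) * p ^ (2 * \<delta> + 1) * (p * n + r)
      + 3 ^ (2 * \<alpha>) * p ^ (2 * (\<delta> + 1))) = 0] (mod 8)"
    unfolding factor_progression m_def .
qed

end
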